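(* Let $n\ge 1$, let $a(z)=\sum_{i=1-n}^{n-1}a_iz^i$ have real coefficients, let $b\in\mathbb R^n$ be nonnegative and nonzero, and suppose that $T_n(a)\ge 0$, $\|a\|_{W}+\|b\|_1<1$ and $\|b\|_1<(1-\|a\|_{W})^2$. Put $A=(2-\|a\|_{W})I_n-T_n(a)$. Then among the solutions $x\in\mathbb R^n$ of the equation $$Ax-\|x\|_1x=b$$ there is exactly one, denoted $x_*$, which satisfies $\|a\|_{W}+\|x_*\|_1<1$.
   Context: $T_n(a)$ is the $n\times n$ Toeplitz matrix with $(T_n(a))_{i,j}=a_{j-i}$ for $1\le i,j\le n$, and $\|a\|_{W}:=\sum_{i=1-n}^{n-1}|a_i|$. $\|\cdot\|_1$ is the vector 1-norm. Inequalities between matrices or vectors are entrywise. *)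

theory Defs
  imports Complex_Main "Jordan_Normal_Form.Matrix"
begin

text \<open>
  A Laurent polynomial $a(z) = \sum_{i=1-n}^{n-1} a_i z^i$ is given by its coefficient family
  \<open>a :: int \<Rightarrow> real\<close>; only the values at indices in \<open>{1 - int n..int n - 1}\<close> are used below.
  Matrix indices start at 0, which leaves the difference $j - i$ unchanged.
\<close>

definition toeplitz_mat :: "nat \<Rightarrow> (int \<Rightarrow> real) \<Rightarrow> real mat" where
  "toeplitz_mat n a = mat n n (\<lambda>(i, j). a (int j - int i))"

definition wiener_norm :: "nat \<Rightarrow> (int \<Rightarrow> real) \<Rightarrow> real" where
  "wiener_norm n a = (\<Sum>i = 1 - int n..int n - 1. \<bar>a i\<bar>)"

definition l1_norm_vec :: "real vec \<Rightarrow> real" where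
  "l1_norm_vec x = (\<Sum>i<dim_vec x. \<bar>x $ i\<bar>)"

end

theory Submission
  imports Defs
begin

text \<open>
  Write \<open>w\<close> for the Wiener norm of \<open>a\<close>, \<open>T\<close> for the Toeplitz matrix and \<open>\<parallel>x\<parallel>\<close> for the
  1-norm. The matrix enters the proof only through its nonnegativity and the fact that \<open>T\<close> has operator
  norm at most \<open>w\<close> for the 1-norm: every column of \<open>T\<close> lists distinct coefficients of \<open>a\<close>
  (\<open>toeplitz_column_sum_le\<close>, \<open>l1_norm_kernel_le\<close>).

  Uniqueness (\<open>quadratic_solution_unique\<close>) is a perturbation estimate. If \<open>x\<close> and \<open>y\<close> are solutions with
  norms \<open>s\<close> and \<open>r\<close>, subtracting the equations gives
  \<open>(2 - w - s) (x - y) = T (x - y) + (s - r) y\<close>, hence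
  \<open>(2 - w - s) \<parallel>x - y\<parallel> \<le> (w + r) \<parallel>x - y\<parallel>\<close>. Since \<open>s\<close> and \<open>r\<close> are both below \<open>1 - w\<close>, the factor
  on the left exceeds the one on the right, and \<open>x = y\<close>.

  Existence (\<open>quadratic_solution_exists\<close>) is a monotone iteration. The equation reads \<open>x = G x\<close> with
  \<open>G x = (b + T x + \<parallel>x\<parallel> x) / (2 - w)\<close>, and \<open>G\<close> is monotone on nonnegative vectors. It maps the part
  of norm at most \<open>r\<close> into itself as soon as \<open>\<parallel>b\<parallel> + w r + r\<^sup>2 \<le> (2 - w) r\<close>, that is
  \<open>(1 - w - r)\<^sup>2 \<le> (1 - w)\<^sup>2 - \<parallel>b\<parallel>\<close>; the hypothesis \<open>\<parallel>b\<parallel> < (1 - w)\<^sup>2\<close> allows such an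
  \<open>r\<close> strictly below \<open>1 - w\<close>. So the iterates of \<open>G\<close> starting at \<open>0\<close> increase, stay bounded, and converge
  entrywise to a solution of norm at most \<open>r\<close>.
\<close>

text \<open>
  For a fixed column \<open>j\<close> the index \<open>j - i\<close> takes every value at most once, and only values in
  the range of summation of the Wiener norm.
\<close>

lemma toeplitz_column_sum_le:
  assumes "j < n"
  shows "(\<Sum>i<n. \<bar>a (int j - int i)\<bar>) \<le> wiener_norm n a"
proof -
  have inj: "inj_on (\<lambda>i. int j - int i) {..<n}"
    by (auto simp: inj_on_def)
  have "(\<Sum>i<n. \<bar>a (int j - int i)\<bar>) = (\<Sum>k\<in>(\<lambda>i. int j - int i) ` {..<n}. \<bar>a k\<bar>)"
    by (simp add: sum.reindex[OF inj])
  also have "\<dots> \<le> wiener_norm n a"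
    unfolding wiener_norm_def using assms by (intro sum_mono2) auto
  finally show ?thesis .
qed

lemma l1_norm_kernel_le:
  fixes t :: "nat \<Rightarrow> nat \<Rightarrow> real"
  assumes col: "\<And>j. j < n \<Longrightarrow> (\<Sum>i<n. \<bar>t i j\<bar>) \<le> w"
  shows "(\<Sum>i<n. \<bar>\<Sum>j<n. t i j * x j\<bar>) \<le> w * (\<Sum>j<n. \<bar>x j\<bar>)"
proof -
  have "(\<Sum>i<n. \<bar>\<Sum>j<n. t i j * x j\<bar>) \<le> (\<Sum>i<n. \<Sum>j<n. \<bar>t i j\<bar> * \<bar>x j\<bar>)"
    by (intro sum_mono order_trans[OF sum_abs]) (simp add: abs_mult)
  also have "\<dots> = (\<Sum>j<n. (\<Sum>i<n. \<bar>t i j\<bar>) * \<bar>x j\<bar>)"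
    by (subst sum.swap) (simp add: sum_distrib_right)
  also have "\<dots> \<le> (\<Sum>j<n. w * \<bar>x j\<bar>)"
    by (intro sum_mono mult_right_mono) (auto simp: col)
  finally show ?thesis
    by (simp add: sum_distrib_left)
qed

text \<open>
  The map \<open>x \<mapsto> T x + \<parallel>x\<parallel> x\<close> has Lipschitz constant at most \<open>w + s + r\<close> between points of norms
  \<open>s\<close> and \<open>r\<close>, and two different solutions would force this constant to be at least \<open>2 - w\<close>,
  whereas the bounds on the two norms give \<open>s + r < 2 - 2 w\<close>.
\<close>

lemma quadratic_solution_unique:
  fixes t :: "nat \<Rightarrow> nat \<Rightarrow> real" and x y b :: "nat \<Rightarrow> real"
  assumes col: "\<And>j. j < n \<Longrightarrow> (\<Sum>i<n. \<bar>t i j\<bar>) \<le> w"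
    and x: "\<And>i. i < n \<Longrightarrow> (2 - w) * x i - (\<Sum>j<n. t i j * x j) - (\<Sum>j<n. \<bar>x j\<bar>) * x i = b i"
    and y: "\<And>i. i < n \<Longrightarrow> (2 - w) * y i - (\<Sum>j<n. t i j * y j) - (\<Sum>j<n. \<bar>y j\<bar>) * y i = b i"
    and x_small: "w + (\<Sum>j<n. \<bar>x j\<bar>) < 1"
    and y_small: "w + (\<Sum>j<n. \<bar>y j\<bar>) < 1"
    and i: "i < n"
  shows "x i = y i"
proof -
  define s where "s = (\<Sum>j<n. \<bar>x j\<bar>)"
  define r where "r = (\<Sum>j<n. \<bar>y j\<bar>)"
  define d where "d = (\<Sum>j<n. \<bar>x j - y j\<bar>)"
  have small: "w + s < 1" "w + r < 1" "0 \<le> r"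
    using x_small y_small by (auto simp: s_def r_def sum_nonneg)
  have "\<bar>s - r\<bar> \<le> d"
  proof -
    have "\<bar>s - r\<bar> = \<bar>\<Sum>j<n. \<bar>x j\<bar> - \<bar>y j\<bar>\<bar>"
      by (simp add: s_def r_def sum_subtractf)
    also have "\<dots> \<le> d"
      unfolding d_def by (intro order_trans[OF sum_abs] sum_mono) (rule abs_triangle_ineq3)
    finally show ?thesis .
  qed
  \<comment> \<open>Splitting \<open>s x - r y = s (x - y) + (s - r) y\<close> keeps the coefficient of \<open>x - y\<close> positive.\<close>
  have diff: "(2 - w - s) * (x i - y i) = (\<Sum>j<n. t i j * (x j - y j)) + (s - r) * y i"
    if "i < n" for i
    using x[OF that] y[OF that]
    by (simp add: s_def[symmetric] r_def[symmetric] right_diff_distrib sum_subtractf)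
       (simp add: algebra_simps)
  have "(2 - w - s) * d = (\<Sum>i<n. \<bar>(2 - w - s) * (x i - y i)\<bar>)"
    using small by (simp add: d_def sum_distrib_left abs_mult)
  also have "\<dots> = (\<Sum>i<n. \<bar>(\<Sum>j<n. t i j * (x j - y j)) + (s - r) * y i\<bar>)"
    by (intro sum.cong refl) (simp add: diff)
  also have "\<dots> \<le> (\<Sum>i<n. \<bar>\<Sum>j<n. t i j * (x j - y j)\<bar> + \<bar>s - r\<bar> * \<bar>y i\<bar>)"
    by (intro sum_mono order_trans[OF abs_triangle_ineq]) (simp add: abs_mult)
  also have "\<dots> = (\<Sum>i<n. \<bar>\<Sum>j<n. t i j * (x j - y j)\<bar>) + \<bar>s - r\<bar> * r"
    by (simp add: sum.distrib r_def sum_distrib_left)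
  also have "\<dots> \<le> w * d + d * r"
    unfolding d_def
    by (intro add_mono l1_norm_kernel_le col mult_right_mono \<open>\<bar>s - r\<bar> \<le> d\<close>[unfolded d_def] \<open>0 \<le> r\<close>)
  finally have "(2 - w - s - w - r) * d \<le> 0"
    by (simp add: algebra_simps)
  moreover have "0 < 2 - w - s - w - r"
    using small by simp
  ultimately have "d \<le> 0"
    by (simp add: mult_le_0_iff)
  then have "\<bar>x i - y i\<bar> \<le> 0"
    using member_le_sum[of i "{..<n}" "\<lambda>j. \<bar>x j - y j\<bar>"] i by (simp add: d_def)
  then show ?thesis by simp
qed

text \<open>
  Monotone iteration turns the norm bound into convergence: each entry of the iterates is an
  increasing sequence bounded by \<open>r\<close>. The limit inherits the bound \<open>r\<close>, and it is a fixed point because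
  the iterated map involves only finite sums and products of the entries.
\<close>

lemma quadratic_solution_exists:
  fixes t :: "nat \<Rightarrow> nat \<Rightarrow> real" and b :: "nat \<Rightarrow> real"
  assumes t: "\<And>i j. i < n \<Longrightarrow> j < n \<Longrightarrow> 0 \<le> t i j"
    and col: "\<And>j. j < n \<Longrightarrow> (\<Sum>i<n. \<bar>t i j\<bar>) \<le> w"
    and b: "\<And>i. i < n \<Longrightarrow> 0 \<le> b i"
    and w: "0 \<le> w" "w < 1"
    and b_small: "(\<Sum>i<n. b i) < (1 - w)\<^sup>2"
  shows "\<exists>x. (\<forall>i<n. (2 - w) * x i - (\<Sum>j<n. t i j * x j) - (\<Sum>j<n. \<bar>x j\<bar>) * x i = b i)
             \<and> w + (\<Sum>j<n. \<bar>x j\<bar>) < 1"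
proof -
  define \<beta> where "\<beta> = (\<Sum>i<n. b i)"
  have "0 \<le> \<beta>"
    unfolding \<beta>_def using b by (intro sum_nonneg) auto
  \<comment> \<open>The smaller root of \<open>\<beta> + w r + r\<^sup>2 = (2 - w) r\<close>.\<close>
  define r where "r = 1 - w - sqrt ((1 - w)\<^sup>2 - \<beta>)"
  have "r < 1 - w"
    using b_small by (simp add: r_def \<beta>_def)
  have "0 \<le> r"
    using \<open>0 \<le> \<beta>\<close> w real_sqrt_le_mono[of "(1 - w)\<^sup>2 - \<beta>" "(1 - w)\<^sup>2"] by (simp add: r_def)
  have "(1 - w - r)\<^sup>2 = (1 - w)\<^sup>2 - \<beta>"
    using b_small by (simp add: r_def \<beta>_def)
  then have root: "\<beta> + w * r + r * r = (2 - w) * r"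
    by (simp add: power2_eq_square algebra_simps)

  define G where
    "G x i = (b i + (\<Sum>j<n. t i j * x j) + (\<Sum>j<n. \<bar>x j\<bar>) * x i) / (2 - w)" for x i
  define u where "u k = (G ^^ k) (\<lambda>_. 0)" for k
  have u_0: "u 0 = (\<lambda>_. 0)" and u_Suc: "u (Suc k) = G (u k)" for k
    by (simp_all add: u_def)
  have G_mono: "G x i \<le> G y i" if "\<forall>j<n. 0 \<le> x j \<and> x j \<le> y j" "i < n" for x y i
  proof -
    have "(\<Sum>j<n. t i j * x j) \<le> (\<Sum>j<n. t i j * y j)"
      using that t by (intro sum_mono mult_left_mono) auto
    moreover have "(\<Sum>j<n. \<bar>x j\<bar>) * x i \<le> (\<Sum>j<n. \<bar>y j\<bar>) * y i"
      using that by (intro mult_mono sum_mono sum_nonneg) (auto simp: abs_of_nonneg order_trans)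
    ultimately show ?thesis
      using w by (simp add: G_def divide_right_mono)
  qed
  have u_mono: "\<forall>i<n. 0 \<le> u k i \<and> u k i \<le> u (Suc k) i" for k
  proof (induction k)
    case 0
    show ?case
      using b w by (simp add: u_Suc u_0 G_def)
  next
    case (Suc k)
    then have "\<forall>i<n. u (Suc k) i \<le> u (Suc (Suc k)) i"
      using G_mono[of "u k" "u (Suc k)"] by (simp add: u_Suc)
    with Suc show ?case by force
  qed
  have G_bound: "(\<Sum>i<n. \<bar>G x i\<bar>) \<le> r" if x: "(\<Sum>j<n. \<bar>x j\<bar>) \<le> r" for x
  proof -
    let ?s = "\<Sum>j<n. \<bar>x j\<bar>"
    have "0 \<le> ?s" by (simp add: sum_nonneg)
    have "(2 - w) * (\<Sum>i<n. \<bar>G x i\<bar>) = (\<Sum>i<n. \<bar>b i + (\<Sum>j<n. t i j * x j) + ?s * x i\<bar>)"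
      using w by (simp add: G_def sum_distrib_left abs_divide)
    also have "\<dots> \<le> (\<Sum>i<n. b i + \<bar>\<Sum>j<n. t i j * x j\<bar> + ?s * \<bar>x i\<bar>)"
    proof (intro sum_mono)
      fix i assume "i \<in> {..<n}"
      then have "0 \<le> b i" using b by simp
      moreover have "\<bar>?s * x i\<bar> = ?s * \<bar>x i\<bar>"
        using \<open>0 \<le> ?s\<close> by (simp add: abs_mult)
      ultimately show "\<bar>b i + (\<Sum>j<n. t i j * x j) + ?s * x i\<bar>
          \<le> b i + \<bar>\<Sum>j<n. t i j * x j\<bar> + ?s * \<bar>x i\<bar>"
        by linarith
    qed
    also have "\<dots> = \<beta> + (\<Sum>i<n. \<bar>\<Sum>j<n. t i j * x j\<bar>) + ?s * ?s"
      by (simp add: sum.distrib \<beta>_def sum_distrib_left)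
    also have "\<dots> \<le> \<beta> + w * ?s + ?s * ?s"
      using l1_norm_kernel_le[of n t w x] col by simp
    also have "\<dots> \<le> \<beta> + w * r + r * r"
      using x w \<open>0 \<le> ?s\<close> \<open>0 \<le> r\<close> by (intro add_mono mult_mono order_refl)
    finally show ?thesis
      using root w by simp
  qed
  have u_bound: "(\<Sum>i<n. \<bar>u k i\<bar>) \<le> r" for k
    by (induction k) (auto simp: u_0 u_Suc \<open>0 \<le> r\<close> G_bound)

  have "convergent (\<lambda>k. u k i)" if "i < n" for i
  proof (rule Bseq_mono_convergent)
    show "Bseq (\<lambda>k. u k i)"
    proof (rule BseqI')
      show "norm (u k i) \<le> r" for k
        using member_le_sum[of i "{..<n}" "\<lambda>j. \<bar>u k j\<bar>"] u_bound[of k] that by simp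
    qed
    show "\<forall>m k. m \<le> k \<longrightarrow> u m i \<le> u k i"
      using lift_Suc_mono_le[of "\<lambda>k. u k i"] u_mono that by blast
  qed
  then have "\<forall>i. \<exists>l. i < n \<longrightarrow> (\<lambda>k. u k i) \<longlonglongrightarrow> l"
    by (auto simp: convergent_def)
  then obtain x where lim: "\<And>i. i < n \<Longrightarrow> (\<lambda>k. u k i) \<longlonglongrightarrow> x i"
    by metis
  have lim_norm: "(\<lambda>k. \<Sum>j<n. \<bar>u k j\<bar>) \<longlonglongrightarrow> (\<Sum>j<n. \<bar>x j\<bar>)"
    by (intro tendsto_sum tendsto_rabs lim) simp
  have fixpoint: "x i = G x i" if "i < n" for i
  proof (rule LIMSEQ_unique)
    show "(\<lambda>k. u (Suc k) i) \<longlonglongrightarrow> x i"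
      using lim[OF that] by (rule LIMSEQ_Suc)
    show "(\<lambda>k. u (Suc k) i) \<longlonglongrightarrow> G x i"
      unfolding u_Suc G_def using w
      by (intro tendsto_divide tendsto_add tendsto_mult tendsto_sum tendsto_const lim lim_norm that)
         auto
  qed
  have "(\<Sum>j<n. \<bar>x j\<bar>) \<le> r"
    using lim_norm u_bound by (intro LIMSEQ_le_const2) auto
  moreover have "(2 - w) * x i - (\<Sum>j<n. t i j * x j) - (\<Sum>j<n. \<bar>x j\<bar>) * x i = b i"
    if "i < n" for i
  proof -
    have "(2 - w) * x i = (2 - w) * G x i"
      using fixpoint[OF that] by simp
    also have "\<dots> = b i + (\<Sum>j<n. t i j * x j) + (\<Sum>j<n. \<bar>x j\<bar>) * x i"
      using w by (simp add: G_def)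
    finally show ?thesis by simp
  qed
  ultimately show ?thesis
    using \<open>r < 1 - w\<close> by (intro exI[of _ x]) auto
qed

lemma toeplitz_quadratic_eq_iff:
  fixes x b :: "real vec"
  assumes x: "x \<in> carrier_vec n" and b: "b \<in> carrier_vec n"
  shows "(c \<cdot>\<^sub>m 1\<^sub>m n - toeplitz_mat n a) *\<^sub>v x - s \<cdot>\<^sub>v x = b \<longleftrightarrow>
    (\<forall>i<n. c * x $ i - (\<Sum>j<n. a (int j - int i) * x $ j) - s * x $ i = b $ i)"
proof -
  have entry: "((c \<cdot>\<^sub>m 1\<^sub>m n - toeplitz_mat n a) *\<^sub>v x) $ i
      = c * x $ i - (\<Sum>j<n. a (int j - int i) * x $ j)" if "i < n" for i
  proof -
    have "((c \<cdot>\<^sub>m 1\<^sub>m n - toeplitz_mat n a) *\<^sub>v x) $ i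
        = (\<Sum>j<n. (c * (if i = j then 1 else 0) - a (int j - int i)) * x $ j)"
      using that x by (auto simp: scalar_prod_def toeplitz_mat_def lessThan_atLeast0 intro!: sum.cong)
    also have "\<dots> = (\<Sum>j<n. (if i = j then c * x $ j else 0) - a (int j - int i) * x $ j)"
      by (intro sum.cong refl) (simp add: algebra_simps)
    also have "\<dots> = c * x $ i - (\<Sum>j<n. a (int j - int i) * x $ j)"
      using that by (simp add: sum_subtractf)
    finally show ?thesis .
  qed
  have dim: "dim_vec ((c \<cdot>\<^sub>m 1\<^sub>m n - toeplitz_mat n a) *\<^sub>v x) = n"
    by (simp add: toeplitz_mat_def)
  show ?thesis
    using x b by (auto simp: vec_eq_iff dim entry simp del: index_mult_mat_vec)
qed

theorem theorem2p3:
  fixes n :: nat and a :: "int \<Rightarrow> real" and b :: "real vec" and A :: "real mat"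
  assumes "n \<ge> 1"
    and "b \<in> carrier_vec n"
    and "0\<^sub>v n \<le> b"
    and "b \<noteq> 0\<^sub>v n"
    and "0\<^sub>m n n \<le> toeplitz_mat n a"
    and "wiener_norm n a + l1_norm_vec b < 1"
    and "l1_norm_vec b < (1 - wiener_norm n a)\<^sup>2"
    and "A = (2 - wiener_norm n a) \<cdot>\<^sub>m 1\<^sub>m n - toeplitz_mat n a"
  shows "\<exists>!x. x \<in> carrier_vec n
              \<and> A *\<^sub>v x - l1_norm_vec x \<cdot>\<^sub>v x = b
              \<and> wiener_norm n a + l1_norm_vec x < 1"
proof -
  let ?w = "wiener_norm n a" and ?t = "\<lambda>i j. a (int j - int i)"
  have norm: "l1_norm_vec x = (\<Sum>j<n. \<bar>x $ j\<bar>)" if "x \<in> carrier_vec n" for x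
    using that by (simp add: l1_norm_vec_def)
  have b: "0 \<le> b $ i" if "i < n" for i
    using assms(2,3) that by (auto simp: less_eq_vec_def)
  have t: "0 \<le> ?t i j" if "i < n" "j < n" for i j
    using assms(5) that by (auto simp: less_eq_mat_def toeplitz_mat_def)
  have norm_b: "l1_norm_vec b = (\<Sum>i<n. b $ i)"
    using b by (simp add: norm[OF assms(2)])
  have "0 \<le> ?w"
    by (simp add: wiener_norm_def sum_nonneg)
  moreover have "?w < 1"
    using assms(6) by (simp add: norm_b) (smt (verit) b lessThan_iff sum_nonneg)
  ultimately obtain f where
      f: "\<forall>i<n. (2 - ?w) * f i - (\<Sum>j<n. ?t i j * f j) - (\<Sum>j<n. \<bar>f j\<bar>) * f i = b $ i"
    and f_small: "?w + (\<Sum>j<n. \<bar>f j\<bar>) < 1"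
    using quadratic_solution_exists[of n ?t ?w "\<lambda>i. b $ i", OF t toeplitz_column_sum_le b]
      assms(7) norm_b by auto
  show ?thesis
  proof (rule ex1I[of _ "vec n f"], intro conjI)
    have norm_f: "l1_norm_vec (vec n f) = (\<Sum>j<n. \<bar>f j\<bar>)"
      by (simp add: l1_norm_vec_def)
    show "vec n f \<in> carrier_vec n"
      by simp
    show "A *\<^sub>v vec n f - l1_norm_vec (vec n f) \<cdot>\<^sub>v vec n f = b"
      unfolding assms(8) using f assms(2) by (subst toeplitz_quadratic_eq_iff) (auto simp: norm_f)
    show "?w + l1_norm_vec (vec n f) < 1"
      using f_small by (simp add: norm_f)
  next
    fix y
    assume y: "y \<in> carrier_vec n \<and> A *\<^sub>v y - l1_norm_vec y \<cdot>\<^sub>v y = b \<and> ?w + l1_norm_vec y < 1"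
    then have y_eq: "\<forall>i<n. (2 - ?w) * y $ i - (\<Sum>j<n. ?t i j * y $ j) - (\<Sum>j<n. \<bar>y $ j\<bar>) * y $ i
        = b $ i"
      using toeplitz_quadratic_eq_iff[of y n b] assms(2) by (auto simp: assms(8) norm)
    have "y $ i = f i" if "i < n" for i
      using y y_eq f f_small that toeplitz_column_sum_le
      by (intro quadratic_solution_unique[of n ?t ?w "\<lambda>i. y $ i" "\<lambda>i. b $ i" f i]) (auto simp: norm)
    then show "y = vec n f"
      using y by auto
  qed
qed

end
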